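(* Let $\mathbf b_1,\dots,\mathbf b_M\in\{0,1\}^N$ be binary input vectors such that each $\mathbf b_m$ contains at most one entry equal to $1$, and such that the dataset has full coverage: for each $i\in\{1,\dots,N\}$ there is at least one $m$ with $b_{m,i}=1$. Let $\mathbf w^{\mathrm{true}}\in\{0,1\}^N$ and let $\hat\ell_\oplus$ be the empirical risk of the XOR node defined in the context. Then $\hat\ell_\oplus$ is strictly convex as a function of $\mathbf w\in\mathbb R^N$.
   Context: The XOR node with weights $\mathbf w\in\mathbb R^N$ maps $\mathbf b\in\{0,1\}^N$ to $f(\mathbf w;\mathbf b)=\frac12\Big(1-\prod_{i=1}^N(w_iz_i+1)\Big)$ with $z_i=-2b_i$. The empirical risk against oracle weights $\mathbf w^{\mathrm{true}}$ is $\hat\ell_\oplus(\mathbf w)=\frac1M\sum_{m=1}^M\big(f(\mathbf w;\mathbf b_m)-f(\mathbf w^{\mathrm{true}};\mathbf b_m)\big)^2$. *)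

theory Defs
  imports "HOL-Analysis.Analysis"
begin

definition strictly_convex_on :: "'a::real_vector set \<Rightarrow> ('a \<Rightarrow> real) \<Rightarrow> bool" where
  "strictly_convex_on S f \<longleftrightarrow> convex S \<and>
    (\<forall>x\<in>S. \<forall>y\<in>S. \<forall>u>0. \<forall>v>0. x \<noteq> y \<longrightarrow> u + v = 1 \<longrightarrow>
      f (u *\<^sub>R x + v *\<^sub>R y) < u * f x + v * f y)"

definition binary_vec :: "real ^ 'n \<Rightarrow> bool" where
  "binary_vec b \<longleftrightarrow> (\<forall>i. b $ i \<in> {0, 1})"

definition xor_node :: "real ^ 'n \<Rightarrow> real ^ 'n \<Rightarrow> real" where
  "xor_node w b = (1 / 2) * (1 - (\<Prod>i\<in>UNIV. w $ i * (- 2 * b $ i) + 1))"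

(* The samples are b 1, ..., b M; values of b outside {1..M} play no role. *)
definition xor_risk :: "nat \<Rightarrow> (nat \<Rightarrow> real ^ 'n) \<Rightarrow> real ^ 'n \<Rightarrow> real ^ 'n \<Rightarrow> real" where
  "xor_risk M b wtrue w =
    (1 / real M) * (\<Sum>m = 1..M. (xor_node w (b m) - xor_node wtrue (b m))\<^sup>2)"

end

(* On inputs with at most one active entry the XOR node is linear, w \<mapsto> w \<bullet> b, so the risk is
   a least-squares loss. Its convexity gap along x, y is (u v / M) \<Sum>\<^sub>m ((x - y) \<bullet> b\<^sub>m)\<^sup>2, which
   full coverage makes positive as soon as x and y differ in some coordinate. *)
theory Submission
  imports Defs
begin

text \<open>The support of a 0/1 vector determines it, so an empty support gives \<open>0\<close>
  and a singleton support gives a unit vector.\<close>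

lemma binary_vec_card_le_1_cases:
  fixes b :: "real ^ 'n"
  assumes "binary_vec b" and "card {i. b $ i = 1} \<le> 1"
  obtains "b = 0" | k where "b = axis k 1"
proof (cases "{i. b $ i = 1} = {}")
  case True
  then have "b = 0"
    using assms(1) by (auto simp: binary_vec_def vec_eq_iff)
  then show ?thesis by (rule that)
next
  case False
  then have "card {i. b $ i = 1} = 1"
    using assms(2) by (metis card_0_eq finite le_less less_one)
  then obtain k where "{i. b $ i = 1} = {k}"
    by (rule card_1_singletonE)
  then have "b $ i = (if i = k then 1 else 0)" for i
    using assms(1) by (auto simp: binary_vec_def)
  then have "b = axis k 1"
    by (simp add: vec_eq_iff axis_def)
  then show ?thesis by (rule that)
qed

text \<open>Every factor with \<open>i \<noteq> k\<close> is 1, so the product collapses to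
  \<open>1 - 2 * w $ k\<close>.\<close>

lemma xor_node_axis: "xor_node w (axis k 1) = w $ k"
proof -
  have "(\<Prod>i\<in>UNIV. w $ i * (- 2 * axis k 1 $ i) + 1)
      = (\<Prod>i\<in>UNIV. if i = k then 1 - 2 * w $ i else 1)"
    by (rule prod.cong) (auto simp: axis_def)
  then show ?thesis
    by (simp add: xor_node_def prod.delta)
qed

lemma xor_node_eq_inner:
  assumes "binary_vec b" and "card {i. b $ i = 1} \<le> 1"
  shows "xor_node w b = w \<bullet> b"
  using assms
proof (cases rule: binary_vec_card_le_1_cases)
  case 1
  then show ?thesis by (simp add: xor_node_def)
next
  case (2 k)
  then show ?thesis by (simp add: xor_node_axis inner_axis)
qed

text \<open>Since \<open>c = u * c + v * c\<close>, the shift by \<open>c\<close> cancels. Applied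
  with \<open>c = wtrue \<bullet> b m\<close>, this makes the convexity gap of the risk independent
  of \<open>wtrue\<close>.\<close>

lemma square_convex_gap:
  fixes p q c u v :: real
  assumes "u + v = 1"
  shows "u * (p - c)\<^sup>2 + v * (q - c)\<^sup>2 - (u * p + v * q - c)\<^sup>2 = u * v * (p - q)\<^sup>2"
proof -
  have "v = 1 - u" using assms by simp
  show ?thesis
    unfolding \<open>v = 1 - u\<close> by (simp add: power2_eq_square algebra_simps)
qed

theorem propositionE3:
  fixes M :: nat and b :: "nat \<Rightarrow> real ^ 'n" and wtrue :: "real ^ 'n"
  assumes "\<And>m. m \<in> {1..M} \<Longrightarrow> binary_vec (b m)"
    and "\<And>m. m \<in> {1..M} \<Longrightarrow> card {i. b m $ i = 1} \<le> 1"
    and "\<And>i. \<exists>m\<in>{1..M}. b m $ i = 1"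
    and "binary_vec wtrue"
  shows "strictly_convex_on UNIV (xor_risk M b wtrue)"
  unfolding strictly_convex_on_def
proof (intro conjI ballI allI impI)
  fix x y :: "real ^ 'n" and u v :: real
  assume u: "u > 0" and v: "v > 0" and "x \<noteq> y" and uv: "u + v = 1"
  have risk: "xor_risk M b wtrue w = (1 / M) * (\<Sum>m = 1..M. (w \<bullet> b m - wtrue \<bullet> b m)\<^sup>2)" for w
    using assms(1,2) by (simp add: xor_risk_def xor_node_eq_inner)
  have gap: "u * xor_risk M b wtrue x + v * xor_risk M b wtrue y
        - xor_risk M b wtrue (u *\<^sub>R x + v *\<^sub>R y)
      = (1 / M) * (\<Sum>m = 1..M. u * v * ((x - y) \<bullet> b m)\<^sup>2)"
  proof -
    \<comment> \<open>The right side is merged into a single sum, whose summands match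
      \<open>square_convex_gap\<close> with \<open>p = x \<bullet> b m\<close> and
      \<open>q = y \<bullet> b m\<close>.\<close>
    have "(\<Sum>m = 1..M. u * v * ((x - y) \<bullet> b m)\<^sup>2)
        = u * (\<Sum>m = 1..M. (x \<bullet> b m - wtrue \<bullet> b m)\<^sup>2)
        + v * (\<Sum>m = 1..M. (y \<bullet> b m - wtrue \<bullet> b m)\<^sup>2)
        - (\<Sum>m = 1..M. ((u *\<^sub>R x + v *\<^sub>R y) \<bullet> b m - wtrue \<bullet> b m)\<^sup>2)"
      by (simp only: inner_diff_left inner_add_left inner_scaleR_left sum_distrib_left
          sum.distrib[symmetric] sum_subtractf[symmetric] square_convex_gap[OF uv])
    then show ?thesis
      by (simp only: risk) (simp add: algebra_simps diff_divide_distrib add_divide_distrib)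
  qed
  from \<open>x \<noteq> y\<close> obtain k where k: "x $ k \<noteq> y $ k"
    by (auto simp: vec_eq_iff)
  from assms(3) obtain n where n: "n \<in> {1..M}" "b n $ k = 1" by blast
  \<comment> \<open>Sample \<open>n\<close> covers coordinate \<open>k\<close>, which must be its
    only active one; its inner product with \<open>x - y\<close> therefore reads off
    \<open>x $ k - y $ k\<close>, which is nonzero.\<close>
  from assms(1,2)[OF n(1)] have "b n = axis k 1"
    using n(2) by (cases rule: binary_vec_card_le_1_cases) (auto simp: axis_def split: if_splits)
  then have "u * v * ((x - y) \<bullet> b n)\<^sup>2 > 0"
    using u v k by (simp add: inner_axis)
  then have "(\<Sum>m = 1..M. u * v * ((x - y) \<bullet> b m)\<^sup>2) > 0"
    using n(1) u v by (intro sum_pos2[of _ n]) auto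
  \<comment> \<open>This keeps the factor \<open>1 / M\<close> positive; for \<open>M = 0\<close> it
    would be 0 by convention.\<close>
  moreover have "M > 0" using n(1) by simp
  ultimately have "0 < u * xor_risk M b wtrue x + v * xor_risk M b wtrue y
      - xor_risk M b wtrue (u *\<^sub>R x + v *\<^sub>R y)"
    unfolding gap by simp
  then show "xor_risk M b wtrue (u *\<^sub>R x + v *\<^sub>R y)
      < u * xor_risk M b wtrue x + v * xor_risk M b wtrue y"
    by simp
qed simp

end
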